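(* Let $D$ be a domain in $\mathbb{C}^+$. If $f:\Omega_D\to\mathbb{H}$ is a slice function, then its twistor transform $\mathcal{F}$ defines a curve $D\to\mathbb{G}r_2(\mathbb{C}^4)$. Moreover, every curve $\gamma:D\to\mathbb{G}r_2(\mathbb{C}^4)$ such that $\xi_6\circ\gamma$ is never zero is the twistor transform of a slice function $f:\Omega_D\to\mathbb{H}$. The function $f$ is slice regular if and only if its twistor transform is a holomorphic curve.
   Context: $\mathbb{H}$ is the algebra of quaternions, $\mathbb{S}=\{x\in\mathbb{H}: x^2=-1\}$, $\mathbb{C}=\mathbb{R}+\mathbb{R}i\subset\mathbb{H}$, $\mathbb{C}^+=\{z\in\mathbb{C}:\operatorname{Im} z>0\}$. For $D\subset\mathbb{C}^+$, $\Omega_D=\{\alpha+I\beta:\alpha+i\beta\in D,\ I\in\mathbb{S}\}$. A slice function $f:\Omega_D\to\mathbb{H}$ is a function of the form $f(\alpha+I\beta)=F_1(\alpha+i\beta)+IF_2(\alpha+i\beta)$, $\alpha+i\beta\in D$, $I\in\mathbb{S}$, with $F_1,F_2:D\to\mathbb{H}$; slice functions are understood to be continuous ($F_1,F_2$ continuous), and "curve" means a continuous map from $D$ (one complex parameter). The slice function is slice regular if $F=F_1+\sqrt{-1}F_2:D\to\mathbb{H}\otimes_{\mathbb{R}}\mathbb{C}$ is $C^1$ and $\frac{\partial F}{\partial\alpha}+\sqrt{-1}\frac{\partial F}{\partial\beta}=0$. $\mathbb{HP}^1$ is the set of classes $[q_1,q_2]=[pq_1,pq_2]$, $p\in\mathbb{H}\setminus\{0\}$,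 with $\mathbb{H}\subset\mathbb{HP}^1$ via $q\mapsto[1,q]$; $\pi:\mathbb{CP}^3\to\mathbb{HP}^1$ is $\pi[X_0,X_1,X_2,X_3]=[X_0+X_1j,X_2+X_3j]$. Let $\mathcal{Q}^+$ be the set of points of $\{X_0X_3=X_1X_2\}\subset\mathbb{CP}^3$ such that $X_0\ne0$ and $X_2/X_0\in\mathbb{C}^+$, or $X_1\neq 0$ and $X_3/X_1\in\mathbb{C}^+$; $\pi$ maps $\mathcal{Q}^+$ bijectively onto $\mathbb{H}\setminus\mathbb{R}$. The twistor lift of $f$ is the map $\tilde f:\pi^{-1}(\Omega_D)\cap\mathcal{Q}^+\to\mathbb{CP}^3$, $\tilde f[X_0,X_1,X_2,X_3]=[X_0,X_1,Y_2,Y_3]$, with $Y_2,Y_3\in\mathbb{C}$ determined by $Y_2+Y_3j=(X_0+X_1j)f(\pi[X_0,X_1,X_2,X_3])$. For $v\in\mathbb{C}^+$ let $l_v=\{[1,u,v,uv]:u\in\mathbb{C}\cup\{\infty\}\}=\{[s,t,sv,tv]:[s,t]\in\mathbb{CP}^1\}\subset\mathcal{Q}^+$. The twistor transform of $f$ is the map $\mathcal{F}:D\to\mathbb{G}r_2(\mathbb{C}^4)$, $\mathcal{F}(v)=\tilde f(l_v)$, where the image is a projective line in $\mathbb{CP}^3$, viewed as a point of the Grassmannian of 2-planes in $\mathbb{C}^4$. $\mathbb{G}r_2(\mathbb{C}^4)$ is identified with the Klein quadric $\xi_1\xi_6-\xi_2\xi_5+\xi_3\xi_4=0$ in $\mathbb{CP}^5$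 as follows: if a line is given by two linear equations with coefficient vectors $a=(a_0,\dots,a_3)$ and $b=(b_0,\dots,b_3)$ then $(\xi_1,\dots,\xi_6)$ are the minors $a_hb_k-a_kb_h$ for $(h,k)=(0,1),(0,2),(0,3),(1,2),(1,3),(2,3)$ in this order. *)

theory Defs
  imports "HOL-Analysis.Analysis"
begin

section \<open>Quaternions\<close>

codatatype quat = Quat (q_re: real) (q_i: real) (q_j: real) (q_k: real)

lemma quat_eq_iff: "x = y \<longleftrightarrow> q_re x = q_re y \<and> q_i x = q_i y \<and> q_j x = q_j y \<and> q_k x = q_k y"
  by (auto intro: quat.expand)

instantiation quat :: ab_group_add
begin

primcorec zero_quat where
  "q_re 0 = 0"
| "q_i 0 = 0"
| "q_j 0 = 0"
| "q_k 0 = 0"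

primcorec plus_quat where
  "q_re (x + y) = q_re x + q_re y"
| "q_i (x + y) = q_i x + q_i y"
| "q_j (x + y) = q_j x + q_j y"
| "q_k (x + y) = q_k x + q_k y"

primcorec uminus_quat where
  "q_re (- x) = - q_re x"
| "q_i (- x) = - q_i x"
| "q_j (- x) = - q_j x"
| "q_k (- x) = - q_k x"

primcorec minus_quat where
  "q_re (x - y) = q_re x - q_re y"
| "q_i (x - y) = q_i x - q_i y"
| "q_j (x - y) = q_j x - q_j y"
| "q_k (x - y) = q_k x - q_k y"

instance
  by standard (simp_all add: quat_eq_iff)

end

instantiation quat :: ring_1
begin

primcorec one_quat where
  "q_re 1 = 1"
| "q_i 1 = 0"
| "q_j 1 = 0"
| "q_k 1 = 0"

primcorec times_quat where
  "q_re (x * y) = q_re x * q_re y - q_i x * q_i y - q_j x * q_j y - q_k x * q_k y"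
| "q_i (x * y) = q_re x * q_i y + q_i x * q_re y + q_j x * q_k y - q_k x * q_j y"
| "q_j (x * y) = q_re x * q_j y - q_i x * q_k y + q_j x * q_re y + q_k x * q_i y"
| "q_k (x * y) = q_re x * q_k y + q_i x * q_j y - q_j x * q_i y + q_k x * q_re y"

instance
  by standard (simp_all add: quat_eq_iff algebra_simps)

end

instantiation quat :: real_algebra_1
begin

primcorec scaleR_quat where
  "q_re (scaleR r x) = r * q_re x"
| "q_i (scaleR r x) = r * q_i x"
| "q_j (scaleR r x) = r * q_j x"
| "q_k (scaleR r x) = r * q_k x"

instance
  by standard (simp_all add: quat_eq_iff algebra_simps)

end

instantiation quat :: real_inner
begin

definition inner_quat :: "quat \<Rightarrow> quat \<Rightarrow> real" where
  "inner_quat x y = q_re x * q_re y + q_i x * q_i y + q_j x * q_j y + q_k x * q_k y"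

definition norm_quat :: "quat \<Rightarrow> real" where
  "norm_quat x = sqrt (inner x x)"

definition sgn_quat :: "quat \<Rightarrow> quat" where
  "sgn_quat x = x /\<^sub>R norm x"

definition dist_quat :: "quat \<Rightarrow> quat \<Rightarrow> real" where
  "dist_quat x y = norm (x - y)"

definition uniformity_quat :: "(quat \<times> quat) filter" where
  "uniformity_quat = (INF e\<in>{0<..}. principal {(x, y). dist x y < e})"

definition open_quat :: "quat set \<Rightarrow> bool" where
  "open_quat U \<longleftrightarrow> (\<forall>x\<in>U. eventually (\<lambda>(x', y). x' = x \<longrightarrow> y \<in> U) uniformity)"

instance
proof
  fix x :: quat
  have eq: "inner x x = (q_re x)\<^sup>2 + (q_i x)\<^sup>2 + (q_j x)\<^sup>2 + (q_k x)\<^sup>2"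
    by (simp add: inner_quat_def power2_eq_square)
  show "0 \<le> inner x x"
    by (simp add: eq)
  have nn: "0 \<le> (q_re x)\<^sup>2" "0 \<le> (q_i x)\<^sup>2" "0 \<le> (q_j x)\<^sup>2" "0 \<le> (q_k x)\<^sup>2"
    by simp_all
  show "inner x x = 0 \<longleftrightarrow> x = 0"
  proof
    assume "inner x x = 0"
    then have "(q_re x)\<^sup>2 = 0" "(q_i x)\<^sup>2 = 0" "(q_j x)\<^sup>2 = 0" "(q_k x)\<^sup>2 = 0"
      using nn unfolding eq by linarith+
    then show "x = 0"
      by (simp add: quat_eq_iff)
  qed (simp add: inner_quat_def)
qed (simp_all add: sgn_quat_def dist_quat_def norm_quat_def uniformity_quat_def open_quat_def
      inner_quat_def algebra_simps)

end

lemma quat_norm_sq: "(norm x)\<^sup>2 = (q_re x)\<^sup>2 + (q_i x)\<^sup>2 + (q_j x)\<^sup>2 + (q_k x)\<^sup>2" for x :: quat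
  unfolding power2_norm_eq_inner by (simp add: inner_quat_def power2_eq_square)

lemma quat_norm_mult: "norm (x * y) = norm x * norm y" for x y :: quat
proof -
  have "(norm (x * y))\<^sup>2 = (norm x * norm y)\<^sup>2"
    unfolding power_mult_distrib quat_norm_sq by (simp, algebra)
  then show ?thesis
    by simp
qed

instantiation quat :: real_normed_div_algebra
begin

definition inverse_quat :: "quat \<Rightarrow> quat" where
  "inverse_quat x = Quat (q_re x) (- q_i x) (- q_j x) (- q_k x) /\<^sub>R (norm x)\<^sup>2"

definition divide_quat :: "quat \<Rightarrow> quat \<Rightarrow> quat" where
  "divide_quat x y = x * inverse y"

instance
proof
  fix x y :: quat
  assume "x \<noteq> 0"
  then have nz: "(norm x)\<^sup>2 \<noteq> 0"
    by simp
  have "Quat (q_re x) (- q_i x) (- q_j x) (- q_k x) * x = (norm x)\<^sup>2 *\<^sub>R 1"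
    unfolding quat_norm_sq by (simp add: quat_eq_iff power2_eq_square)
  then show "inverse x * x = 1"
    using nz by (simp add: inverse_quat_def)
  have "x * Quat (q_re x) (- q_i x) (- q_j x) (- q_k x) = (norm x)\<^sup>2 *\<^sub>R 1"
    unfolding quat_norm_sq by (simp add: quat_eq_iff power2_eq_square)
  then show "x * inverse x = 1"
    using nz by (simp add: inverse_quat_def)
next
  show "inverse (0 :: quat) = 0"
    by (simp add: inverse_quat_def)
qed (simp_all add: divide_quat_def quat_norm_mult)

end

text \<open>
  A quaternion is written \<open>z + w j\<close> with complex \<open>z\<close> and \<open>w\<close>; as \<open>i j = k\<close>, the coefficient of
  \<open>k\<close> is the imaginary part of \<open>w\<close>.
\<close>

definition quat_of_complex :: "complex \<Rightarrow> quat" where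
  "quat_of_complex z = Quat (Re z) (Im z) 0 0"

definition quat_j :: quat where
  "quat_j = Quat 0 0 1 0"

definition quat_of_pair :: "complex \<Rightarrow> complex \<Rightarrow> quat" where
  "quat_of_pair z w = quat_of_complex z + quat_of_complex w * quat_j"

lemma quat_of_pair_Quat: "quat_of_pair z w = Quat (Re z) (Im z) (Re w) (Im w)"
  by (simp add: quat_of_pair_def quat_of_complex_def quat_j_def quat_eq_iff)

lemma quat_of_complex_mult: "quat_of_complex (z * w) = quat_of_complex z * quat_of_complex w"
  by (simp add: quat_of_complex_def quat_eq_iff)

lemma quat_of_pair_scale:
  "quat_of_pair (c * z) (c * w) = quat_of_complex c * quat_of_pair z w"
  by (simp add: quat_of_pair_def quat_of_complex_mult distrib_left mult.assoc)

lemma quat_of_pair_inject [simp]: "quat_of_pair z w = quat_of_pair z' w' \<longleftrightarrow> z = z' \<and> w = w'"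
  by (auto simp: quat_of_pair_Quat complex_eq_iff)

lemma quat_of_pair_surj: "\<exists>z w. q = quat_of_pair z w"
  by (rule exI[of _ "Complex (q_re q) (q_i q)"], rule exI[of _ "Complex (q_j q) (q_k q)"])
     (simp add: quat_of_pair_Quat)

definition imag_units :: "quat set" where
  "imag_units = {x. x\<^sup>2 = - 1}"


section \<open>Slice functions and slice regular functions\<close>

definition upper_half_plane :: "complex set" where
  "upper_half_plane = {z. Im z > 0}"

definition circularization :: "complex set \<Rightarrow> quat set" where
  "circularization D = {of_real a + I * of_real b | a b I. Complex a b \<in> D \<and> I \<in> imag_units}"

text \<open>
  \<open>\<H> \<otimes> \<complex>\<close> is represented by pairs: \<open>(a, b)\<close> stands for \<open>a + \<surd>(-1) b\<close>, where \<open>\<surd>(-1)\<close> is the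
  central imaginary unit of the second factor and acts by \<open>(a, b) \<mapsto> (- b, a)\<close>.
\<close>

definition sqrt_minus_one_times :: "quat \<times> quat \<Rightarrow> quat \<times> quat" where
  "sqrt_minus_one_times x = (- snd x, fst x)"

definition slice_function_of :: "complex set \<Rightarrow> (complex \<Rightarrow> quat \<times> quat) \<Rightarrow> (quat \<Rightarrow> quat) \<Rightarrow> bool" where
  "slice_function_of D F f \<longleftrightarrow>
    (\<forall>a b. \<forall>I\<in>imag_units. Complex a b \<in> D \<longrightarrow>
      f (of_real a + I * of_real b) = fst (F (Complex a b)) + I * snd (F (Complex a b)))"

definition slice_function :: "complex set \<Rightarrow> (quat \<Rightarrow> quat) \<Rightarrow> bool" where
  "slice_function D f \<longleftrightarrow> (\<exists>F. slice_function_of D F f \<and> continuous_on D F)"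

text \<open>
  The Cauchy-Riemann equation is stated with the total derivative \<open>F'\<close>, whose values at \<open>1\<close> and
  \<open>\<i>\<close> are the partial derivatives by the real and the imaginary part.
\<close>

definition slice_regular :: "complex set \<Rightarrow> (quat \<Rightarrow> quat) \<Rightarrow> bool" where
  "slice_regular D f \<longleftrightarrow>
    (\<exists>F F'. slice_function_of D F f \<and>
      (\<forall>z\<in>D. (F has_derivative blinfun_apply (F' z)) (at z)) \<and>
      continuous_on D F' \<and>
      (\<forall>z\<in>D. blinfun_apply (F' z) 1 + sqrt_minus_one_times (blinfun_apply (F' z) \<i>) = 0))"


section \<open>Projective spaces and the Grassmannian\<close>

text \<open>
  A point of complex projective space is a one-dimensional subspace, and \<open>[x]\<close> is the span of \<open>x\<close>.
  Components of vectors are numbered from \<open>1\<close>, so that the homogeneous coordinates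
  \<open>X\<^sub>0, \<dots>, X\<^sub>3\<close> are \<open>X $ 1, \<dots>, X $ 4\<close>.
\<close>

definition proj_space :: "(complex ^ 'n) set set" where
  "proj_space = {L. vec.subspace L \<and> vec.dim L = 1}"

definition proj_point :: "complex ^ 'n \<Rightarrow> (complex ^ 'n) set" where
  "proj_point x = vec.span {x}"

text \<open>The quotient topology for the map \<open>x \<mapsto> [x]\<close> on the nonzero vectors.\<close>

definition proj_topology :: "(complex ^ 'n) set topology" where
  "proj_topology = topology (\<lambda>U. U \<subseteq> proj_space \<and> open {x. x \<noteq> 0 \<and> proj_point x \<in> U})"

lemma openin_proj_topology:
  "openin proj_topology U \<longleftrightarrow> U \<subseteq> proj_space \<and> open {x. x \<noteq> 0 \<and> proj_point x \<in> U}"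
proof -
  let ?P = "\<lambda>U. U \<subseteq> proj_space \<and> open {x. x \<noteq> 0 \<and> proj_point x \<in> U}"
  have "istopology ?P"
    unfolding istopology_def
  proof (intro conjI allI impI)
    fix S T :: "(complex ^ 'n) set set"
    assume "?P S" "?P T"
    moreover have "{x. x \<noteq> 0 \<and> proj_point x \<in> S \<inter> T} =
        {x. x \<noteq> 0 \<and> proj_point x \<in> S} \<inter> {x. x \<noteq> 0 \<and> proj_point x \<in> T}"
      by auto
    ultimately show "S \<inter> T \<subseteq> proj_space" "open {x. x \<noteq> 0 \<and> proj_point x \<in> S \<inter> T}"
      by auto
  next
    fix \<K> :: "(complex ^ 'n) set set set"
    assume K: "\<forall>K\<in>\<K>. ?P K"
    have "{x. x \<noteq> 0 \<and> proj_point x \<in> \<Union>\<K>} = (\<Union>K\<in>\<K>. {x. x \<noteq> 0 \<and> proj_point x \<in> K})"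
      by auto
    with K show "\<Union>\<K> \<subseteq> proj_space" "open {x. x \<noteq> 0 \<and> proj_point x \<in> \<Union>\<K>}"
      by auto
  qed
  then show ?thesis
    unfolding proj_topology_def by (subst topology_inverse') simp_all
qed

lemma proj_point_eq: "proj_point x = range (\<lambda>c. c *s x)"
  by (simp add: proj_point_def vec.span_singleton)

lemma proj_point_in_proj_space: "x \<noteq> 0 \<Longrightarrow> proj_point x \<in> proj_space"
  by (simp add: proj_point_def proj_space_def vec.dim_span)

lemma proj_space_eq: "proj_space = proj_point ` {x. x \<noteq> 0}"
proof
  show "proj_space \<subseteq> proj_point ` {x :: complex ^ 'n. x \<noteq> 0}"
  proof
    fix L :: "(complex ^ 'n) set"
    assume "L \<in> proj_space"
    then have L: "vec.subspace L" "vec.dim L = 1"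
      by (auto simp: proj_space_def)
    obtain B where B: "B \<subseteq> L" "vec.independent B" "L \<subseteq> vec.span B" "card B = vec.dim L"
      using vec.basis_exists by blast
    with L obtain x where "B = {x}"
      by (auto simp: card_1_singleton_iff)
    then show "L \<in> proj_point ` {x. x \<noteq> 0}"
      using B L vec.dependent_zero[of B] vec.span_minimal[of B L]
      by (auto simp: proj_point_def)
  qed
qed (auto intro: proj_point_in_proj_space)

text \<open>The affine coordinate \<open>x\<^sub>j / x\<^sub>i\<close>, defined at the points where \<open>x\<^sub>i \<noteq> 0\<close>.\<close>

definition coord_nonzero :: "'n \<Rightarrow> (complex ^ 'n) set \<Rightarrow> bool" where
  "coord_nonzero i L \<longleftrightarrow> (\<exists>x\<in>L. x $ i \<noteq> 0)"

definition affine_coord :: "'n \<Rightarrow> 'n \<Rightarrow> (complex ^ 'n) set \<Rightarrow> complex" where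
  "affine_coord i j L = (THE c. \<forall>x\<in>L. x $ j = c * x $ i)"

lemma coord_nonzero_proj_point [simp]: "coord_nonzero i (proj_point x) \<longleftrightarrow> x $ i \<noteq> 0"
  by (auto simp: coord_nonzero_def proj_point_eq intro: exI[of _ 1])

lemma affine_coord_proj_point:
  assumes "x $ i \<noteq> 0"
  shows "affine_coord i j (proj_point x) = x $ j / x $ i"
  unfolding affine_coord_def
proof (rule the_equality)
  show "\<forall>y\<in>proj_point x. y $ j = x $ j / x $ i * y $ i"
    using assms by (auto simp: proj_point_eq)
  fix c
  assume "\<forall>y\<in>proj_point x. y $ j = c * y $ i"
  then have "(1 *s x) $ j = c * (1 *s x) $ i"
    unfolding proj_point_eq by blast
  then show "c = x $ j / x $ i"
    using assms by simp
qed

text \<open>Holomorphy with respect to the standard atlas of projective space.\<close>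

definition proj_holomorphic_on :: "(complex \<Rightarrow> (complex ^ 'n) set) \<Rightarrow> complex set \<Rightarrow> bool" where
  "proj_holomorphic_on g D \<longleftrightarrow>
    continuous_map (top_of_set D) proj_topology g \<and>
    (\<forall>i j. (\<lambda>v. affine_coord i j (g v)) holomorphic_on {v \<in> D. coord_nonzero i (g v)})"

definition Gr2 :: "(complex ^ 4) set set" where
  "Gr2 = {V. vec.subspace V \<and> vec.dim V = 2}"

definition line_of_equations :: "complex ^ 4 \<Rightarrow> complex ^ 4 \<Rightarrow> (complex ^ 4) set" where
  "line_of_equations a b =
    {x. (\<Sum>h\<in>UNIV. a $ h * x $ h) = 0 \<and> (\<Sum>h\<in>UNIV. b $ h * x $ h) = 0}"

definition minors :: "complex ^ 4 \<Rightarrow> complex ^ 4 \<Rightarrow> complex ^ 6" where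
  "minors a b = (let m = (\<lambda>h k. a $ h * b $ k - a $ k * b $ h)
    in vector [m 1 2, m 1 3, m 1 4, m 2 3, m 2 4, m 3 4])"

text \<open>
  Two pairs of equations of the same plane differ by an invertible two-by-two matrix, whose
  determinant rescales the minors; hence the point below is unique for \<open>V \<in> Gr2\<close>.
\<close>

definition klein :: "(complex ^ 4) set \<Rightarrow> (complex ^ 6) set" where
  "klein V = (THE P. \<exists>a b. V = line_of_equations a b \<and> P = proj_point (minors a b))"

text \<open>\<open>Gr2\<close> carries the structure of the Klein quadric, as a subvariety of projective space.\<close>

definition Gr2_topology :: "(complex ^ 4) set topology" where
  "Gr2_topology = pullback_topology Gr2 klein proj_topology"

definition Gr2_curve :: "complex set \<Rightarrow> (complex \<Rightarrow> (complex ^ 4) set) \<Rightarrow> bool" where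
  "Gr2_curve D \<gamma> \<longleftrightarrow> continuous_map (top_of_set D) Gr2_topology \<gamma>"

definition Gr2_holomorphic_curve :: "complex set \<Rightarrow> (complex \<Rightarrow> (complex ^ 4) set) \<Rightarrow> bool" where
  "Gr2_holomorphic_curve D \<gamma> \<longleftrightarrow> Gr2_curve D \<gamma> \<and> proj_holomorphic_on (klein \<circ> \<gamma>) D"


section \<open>Twistor lift and twistor transform\<close>

definition HP_class :: "quat \<times> quat \<Rightarrow> (quat \<times> quat) set" where
  "HP_class q = {(p * fst q, p * snd q) | p. p \<noteq> 0}"

definition HP_of_quat :: "quat \<Rightarrow> (quat \<times> quat) set" where
  "HP_of_quat q = HP_class (1, q)"

lemma HP_of_quat_inject: "HP_of_quat q = HP_of_quat q' \<longleftrightarrow> q = q'"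
proof
  assume "HP_of_quat q = HP_of_quat q'"
  moreover have "(1, q) \<in> HP_of_quat q"
    unfolding HP_of_quat_def HP_class_def by (intro CollectI exI[of _ 1]) simp
  ultimately have "(1, q) \<in> HP_of_quat q'"
    by simp
  then show "q = q'"
    by (auto simp: HP_of_quat_def HP_class_def)
qed simp

text \<open>
  All nonzero vectors of the line \<open>L\<close> give the same class, so that the union consists of one class;
  see \<open>twistor_proj_point\<close>.
\<close>

definition twistor_proj :: "(complex ^ 4) set \<Rightarrow> (quat \<times> quat) set" where
  "twistor_proj L =
    (\<Union>X\<in>L - {0}. HP_class (quat_of_pair (X $ 1) (X $ 2), quat_of_pair (X $ 3) (X $ 4)))"

definition Q_plus :: "(complex ^ 4) set set" where
  "Q_plus = {proj_point X | X. X \<noteq> 0 \<and> X $ 1 * X $ 4 = X $ 2 * X $ 3 \<and>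
    (X $ 1 \<noteq> 0 \<and> X $ 3 / X $ 1 \<in> upper_half_plane \<or>
     X $ 2 \<noteq> 0 \<and> X $ 4 / X $ 2 \<in> upper_half_plane)}"

definition twistor_domain :: "complex set \<Rightarrow> (complex ^ 4) set set" where
  "twistor_domain D = {L \<in> Q_plus. twistor_proj L \<in> HP_of_quat ` circularization D}"

text \<open>
  The formula of the twistor lift is complex linear in the vector \<open>X\<close> of the line \<open>L\<close>, so the image
  of the point \<open>L\<close> is the set of the images of its vectors; see \<open>twistor_lift_point\<close>.
\<close>

definition twistor_lift ::
    "complex set \<Rightarrow> (quat \<Rightarrow> quat) \<Rightarrow> (complex ^ 4) set \<Rightarrow> (complex ^ 4) set" where
  "twistor_lift D f = (\<lambda>L\<in>twistor_domain D.
    {vector [X $ 1, X $ 2, Y2, Y3] | X Y2 Y3. X \<in> L \<and>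
      quat_of_pair Y2 Y3 = quat_of_pair (X $ 1) (X $ 2) * f (inv HP_of_quat (twistor_proj L))})"

definition l_line :: "complex \<Rightarrow> (complex ^ 4) set set" where
  "l_line v = {proj_point (vector [s, t, s * v, t * v]) | s t. (s, t) \<noteq> (0, 0)}"

text \<open>
  The projective line \<open>twistor_lift D f ` l_line v\<close> is a set of one-dimensional subspaces; the
  corresponding two-dimensional subspace is their union (see \<open>points_of_plane\<close>).
\<close>

definition twistor_transform ::
    "complex set \<Rightarrow> (quat \<Rightarrow> quat) \<Rightarrow> complex \<Rightarrow> (complex ^ 4) set" where
  "twistor_transform D f = (\<lambda>v\<in>D. \<Union> (twistor_lift D f ` l_line v))"

lemma HP_class_scale:
  assumes "p \<noteq> 0"
  shows "HP_class (p * q1, p * q2) = HP_class (q1, q2)"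
proof
  show "HP_class (p * q1, p * q2) \<subseteq> HP_class (q1, q2)"
  proof
    fix y assume "y \<in> HP_class (p * q1, p * q2)"
    then obtain r where "r \<noteq> 0" "y = (r * (p * q1), r * (p * q2))"
      by (auto simp: HP_class_def)
    then have "r * p \<noteq> 0" "y = (r * p * q1, r * p * q2)"
      using assms by (simp_all add: mult.assoc)
    then show "y \<in> HP_class (q1, q2)"
      unfolding HP_class_def by auto
  qed
  show "HP_class (q1, q2) \<subseteq> HP_class (p * q1, p * q2)"
  proof
    fix y assume "y \<in> HP_class (q1, q2)"
    then obtain r where "r \<noteq> 0" "y = (r * q1, r * q2)"
      by (auto simp: HP_class_def)
    then have "r * inverse p \<noteq> 0" "y = (r * inverse p * (p * q1), r * inverse p * (p * q2))"
      using assms by (simp_all add: mult.assoc) (simp_all add: mult.assoc[symmetric])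
    then show "y \<in> HP_class (p * q1, p * q2)"
      unfolding HP_class_def by auto
  qed
qed

lemma twistor_proj_point:
  assumes "X \<noteq> 0"
  shows "twistor_proj (proj_point X) =
    HP_class (quat_of_pair (X $ 1) (X $ 2), quat_of_pair (X $ 3) (X $ 4))"
proof -
  have eq: "proj_point X - {0} = (\<lambda>c. c *s X) ` (- {0})"
    using assms by (auto simp: proj_point_eq)
  have nz: "quat_of_complex c \<noteq> 0" if "c \<noteq> 0" for c
    using that by (auto simp: quat_of_complex_def quat_eq_iff complex_eq_iff)
  show ?thesis
    unfolding twistor_proj_def eq
    using nz by (auto simp: quat_of_pair_scale HP_class_scale intro!: bexI[of _ 1])
qed

lemma twistor_lift_point:
  assumes "proj_point X \<in> twistor_domain D"
    and "quat_of_pair Y2 Y3 =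
      quat_of_pair (X $ 1) (X $ 2) * f (inv HP_of_quat (twistor_proj (proj_point X)))"
  shows "twistor_lift D f (proj_point X) = proj_point (vector [X $ 1, X $ 2, Y2, Y3])"
proof -
  have scale: "c *s vector [x1, x2, x3, x4] = (vector [c * x1, c * x2, c * x3, c * x4] :: complex ^ 4)"
    for c x1 x2 x3 x4 :: complex
    by (simp add: vec_eq_iff vector_def)
  have "quat_of_pair Z W = quat_of_pair (c * X $ 1) (c * X $ 2) *
      f (inv HP_of_quat (twistor_proj (proj_point X))) \<longleftrightarrow> Z = c * Y2 \<and> W = c * Y3" for c Z W
    by (simp add: quat_of_pair_scale mult.assoc assms(2)[symmetric])
       (simp add: quat_of_pair_scale[symmetric])
  note rep = this
  let ?q = "f (inv HP_of_quat (twistor_proj (proj_point X)))"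
  show ?thesis
  proof (intro subset_antisym subsetI)
    fix Y assume "Y \<in> twistor_lift D f (proj_point X)"
    then obtain c Z W where "Y = vector [c * X $ 1, c * X $ 2, Z, W]"
        "quat_of_pair Z W = quat_of_pair (c * X $ 1) (c * X $ 2) * ?q"
      using assms(1) by (auto simp: twistor_lift_def) (auto simp: proj_point_eq)
    then have "Y = c *s vector [X $ 1, X $ 2, Y2, Y3]"
      using rep scale by simp
    then show "Y \<in> proj_point (vector [X $ 1, X $ 2, Y2, Y3])"
      by (auto simp: proj_point_eq)
  next
    fix Y :: "complex ^ 4" assume "Y \<in> proj_point (vector [X $ 1, X $ 2, Y2, Y3])"
    then obtain c where "Y = c *s vector [X $ 1, X $ 2, Y2, Y3]"
      unfolding proj_point_eq by blast
    then have c: "Y = vector [c * X $ 1, c * X $ 2, c * Y2, c * Y3]"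
      by (simp only: scale)
    have "Y = vector [(c *s X) $ 1, (c *s X) $ 2, c * Y2, c * Y3] \<and> c *s X \<in> proj_point X \<and>
        quat_of_pair (c * Y2) (c * Y3) = quat_of_pair ((c *s X) $ 1) ((c *s X) $ 2) * ?q"
      using c rep by (auto simp: proj_point_def vec.span_base vec.span_scale)
    then show "Y \<in> twistor_lift D f (proj_point X)"
      unfolding twistor_lift_def restrict_apply if_P[OF assms(1)] by blast
  qed
qed

lemma points_of_plane:
  assumes "S \<subseteq> proj_space" "\<Union>S = V"
  shows "S = {L \<in> proj_space. L \<subseteq> V}"
proof -
  have "L \<in> S" if L: "L \<in> proj_space" "L \<subseteq> V" for L
  proof -
    obtain x where x: "x \<noteq> 0" "L = proj_point x"
      using L(1) by (auto simp: proj_space_eq)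
    then have "x \<in> L"
      by (simp add: proj_point_def vec.span_base)
    then obtain M where M: "M \<in> S" "x \<in> M"
      using L(2) assms(2) by blast
    then obtain y where y: "M = proj_point y"
      using assms(1) by (auto simp: proj_space_eq)
    then obtain c where "x = c *s y"
      using M(2) by (auto simp: proj_point_eq)
    moreover from this have "c \<noteq> 0"
      using x(1) by auto
    ultimately have "M = L"
      unfolding x(2) y proj_point_def using vec.span_image_scale[of "{y}" "\<lambda>_. c"] by simp
    with M show ?thesis by simp
  qed
  then show ?thesis
    using assms by blast
qed

end

theory Submission
  imports Defs "HOL-Complex_Analysis.Cauchy_Integral_Formula"
begin

text \<open>
  The theorem rests on the isomorphism of \<open>\<H> \<otimes> \<complex>\<close> with the algebra of complex two-by-two matrices. The
  elements of \<open>\<H> \<otimes> \<complex>\<close> act complex linearly on \<open>\<H> \<cong> \<complex>\<^sup>2\<close> by \<open>p \<cdot> (F\<^sub>1 + \<surd>(-1) F\<^sub>2) = p F\<^sub>1 + i p F\<^sub>2\<close>. If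
  \<open>w = p\<^sup>-\<^sup>1 v p\<close> is the quaternion below a point of the line over \<open>v\<close>, then \<open>p f(w)\<close> is exactly the result
  of this action of \<open>F(v)\<close> on \<open>p\<close> (\<open>twistor_lift_l_line\<close>). Therefore the twistor transform at \<open>v\<close> is the
  graph of the matrix that corresponds to \<open>F(v)\<close> (\<open>twistor_transform_eq_graph_plane\<close>).

  On the other side, the planes that are graphs of two-by-two matrices are those with \<open>\<xi>\<^sub>6 \<noteq> 0\<close>, and
  up to sign the four entries of the matrix are the affine coordinates \<open>\<xi>\<^sub>2, \<dots>, \<xi>\<^sub>5\<close> of this chart of
  the Klein quadric, while \<open>\<xi>\<^sub>1\<close> is the determinant (\<open>klein_graph_plane\<close>, \<open>graph_plane_of_klein\<close>).

  So continuous curves with \<open>\<xi>\<^sub>6 \<noteq> 0\<close> amount to continuous matrix functions on \<open>D\<close>, hence to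
  continuous stem functions \<open>F\<close>, hence to slice functions. The curve is holomorphic if and only if the
  matrix entries are; and as the isomorphism takes \<open>\<surd>(-1)\<close> to the scalar \<open>i\<close>, this is the
  Cauchy-Riemann equation for \<open>F\<close>, which is slice regularity.
\<close>

section \<open>Equations of planes and the Klein point\<close>

lemma vector_4_nth [simp]:
  "(vector [a, b, c, d] :: 'a::zero ^ 4) $ 1 = a"
  "(vector [a, b, c, d] :: 'a::zero ^ 4) $ 2 = b"
  "(vector [a, b, c, d] :: 'a::zero ^ 4) $ 3 = c"
  "(vector [a, b, c, d] :: 'a::zero ^ 4) $ 4 = d"
  by (simp_all add: vector_def)

lemma vector_6_nth [simp]:
  "(vector [a, b, c, d, e, f] :: 'a::zero ^ 6) $ 1 = a"
  "(vector [a, b, c, d, e, f] :: 'a::zero ^ 6) $ 2 = b"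
  "(vector [a, b, c, d, e, f] :: 'a::zero ^ 6) $ 3 = c"
  "(vector [a, b, c, d, e, f] :: 'a::zero ^ 6) $ 4 = d"
  "(vector [a, b, c, d, e, f] :: 'a::zero ^ 6) $ 5 = e"
  "(vector [a, b, c, d, e, f] :: 'a::zero ^ 6) $ 6 = f"
  by (simp_all add: vector_def)

lemma forall_6: "(\<forall>i::6. P i) \<longleftrightarrow> P 1 \<and> P 2 \<and> P 3 \<and> P 4 \<and> P 5 \<and> P 6"
proof -
  have "i = 1 \<or> i = 2 \<or> i = 3 \<or> i = 4 \<or> i = 5 \<or> i = 6" for i :: 6
  proof (induct i)
    case (of_int z)
    then have "z = 0 \<or> z = 1 \<or> z = 2 \<or> z = 3 \<or> z = 4 \<or> z = 5" by simp arith
    then show ?case by auto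
  qed
  then show ?thesis by metis
qed

lemmas minors_simps = minors_def Let_def

text \<open>
  The pairing is bilinear, not Hermitian: \<open>dot a\<close> is the linear form with coefficient vector \<open>a\<close>.
\<close>

abbreviation dot :: "complex ^ 4 \<Rightarrow> complex ^ 4 \<Rightarrow> complex" where
  "dot a x \<equiv> \<Sum>h\<in>UNIV. a $ h * x $ h"

lemma dot_linear:
  "dot a (x + y) = dot a x + dot a y" "dot a (c *s x) = c * dot a x"
  "dot (a + b) x = dot a x + dot b x" "dot (c *s a) x = c * dot a x"
  by (simp_all add: sum_4 algebra_simps)

lemma dot_axis: "dot a (axis i 1) = a $ i"
  by (simp add: axis_def if_distrib[where f="\<lambda>t. _ * t"] cong: if_cong)

text \<open>
  A basis of the plane \<open>V\<close> is completed by \<open>y\<close> and \<open>z\<close> to a basis of \<open>\<complex>\<^sup>4\<close>; the forms \<open>a\<close> and \<open>b\<close> are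
  the last two coordinates in this basis. They cut out \<open>V\<close>, and since a form that vanishes on \<open>V\<close> is
  determined by its values at \<open>y\<close> and \<open>z\<close>, they form a basis of the annihilator of \<open>V\<close>.
\<close>

lemma Gr2_dual_basis:
  assumes "V \<in> Gr2"
  obtains a b y z where
    "V = line_of_equations a b"
    "dot a y = 1" "dot a z = 0" "dot b y = 0" "dot b z = 1"
    "\<And>c. (\<And>x. x \<in> V \<Longrightarrow> dot c x = 0) \<Longrightarrow> c = dot c y *s a + dot c z *s b"
proof -
  have V: "vec.subspace V" "vec.dim V = 2"
    using assms by (auto simp: Gr2_def)
  obtain B where B: "B \<subseteq> V" "vec.independent B" "V \<subseteq> vec.span B" "card B = 2"
    using vec.basis_exists[of V] V by metis
  obtain C where C: "B \<subseteq> C" "vec.independent C" "UNIV \<subseteq> vec.span C"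
    using vec.maximal_independent_subset_extend[of B UNIV] B(2) by auto
  have fin: "finite B" "finite C"
    using B C by (auto intro: vec.finiteI_independent)
  have "card C = 4"
    using vec.basis_card_eq_dim[of C UNIV] C by (simp add: vec_dim_card del: vec.dim_UNIV)
  then have "card (C - B) = 2"
    using card_Diff_subset[of B C] B C fin by simp
  then obtain y z where yz: "C - B = {y, z}" "y \<noteq> z"
    by (auto simp: card_2_iff)
  obtain u w where uw: "B = {u, w}" "u \<noteq> w"
    using B(4) by (auto simp: card_2_iff)
  have C_eq: "C = {u, w, y, z}" and ne: "distinct [u, w, y, z]"
    using yz uw C(1) by auto
  have V_eq: "V = vec.span {u, w}"
    using B V vec.span_minimal[of B V] uw by auto
  let ?e = "\<lambda>x. if x = u then axis 1 1 else if x = w then axis 2 1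
    else if x = y then axis 3 1 else (axis 4 1 :: complex ^ 4)"
  obtain g where g: "Vector_Spaces.linear (*s) (*s) g" "\<forall>x\<in>C. g x = ?e x"
    using vec.linear_independent_extend[OF C(2), of ?e] by blast
  interpret g: Vector_Spaces.linear "(*s)" "(*s)" g by fact
  have gb: "g u = axis 1 1" "g w = axis 2 1" "g y = axis 3 1" "g z = axis 4 1"
    using g(2) ne by (auto simp: C_eq)
  have coords: "x = (g x) $ 1 *s u + (g x) $ 2 *s w + (g x) $ 3 *s y + (g x) $ 4 *s z" for x
  proof -
    have "x \<in> vec.span {u, w, y, z}"
      using C(3) C_eq by auto
    then obtain c1 c2 c3 c4 where x: "x = c1 *s u + c2 *s w + c3 *s y + c4 *s z"
      by (auto simp: vec.span_breakdown_eq algebra_simps)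
    have "g x = c1 *s axis 1 1 + c2 *s axis 2 1 + c3 *s axis 3 1 + c4 *s axis 4 1"
      unfolding x by (simp add: g.add g.scale gb)
    then have "(g x) $ 1 = c1" "(g x) $ 2 = c2" "(g x) $ 3 = c3" "(g x) $ 4 = c4"
      by (simp_all add: axis_def)
    with x show ?thesis by simp
  qed
  define a where "a = matrix g $ 3"
  define b where "b = matrix g $ 4"
  have ab: "dot a x = (g x) $ 3" "dot b x = (g x) $ 4" for x
    using arg_cong[OF matrix_works[OF g(1), of x], of "\<lambda>v. v $ 3"]
      arg_cong[OF matrix_works[OF g(1), of x], of "\<lambda>v. v $ 4"]
    by (simp_all add: a_def b_def matrix_vector_mult_def)
  show thesis
  proof (rule that[of a b y z])
    show "V = line_of_equations a b"
    proof (intro subset_antisym subsetI)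
      fix x assume "x \<in> V"
      then obtain c1 c2 where "x = c1 *s u + c2 *s w"
        unfolding V_eq by (auto simp: vec.span_breakdown_eq algebra_simps)
      then show "x \<in> line_of_equations a b"
        unfolding line_of_equations_def ab by (simp add: g.add g.scale gb axis_def)
    next
      fix x assume "x \<in> line_of_equations a b"
      then have "(g x) $ 3 = 0" "(g x) $ 4 = 0"
        by (simp_all add: line_of_equations_def ab)
      then have "x = (g x) $ 1 *s u + (g x) $ 2 *s w"
        using coords[of x] by simp
      then show "x \<in> V"
        unfolding V_eq
        by (metis insertCI vec.span_add vec.span_base vec.span_scale)
    qed
    show "dot a y = 1" "dot a z = 0" "dot b y = 0" "dot b z = 1"
      unfolding ab by (simp_all add: gb axis_def)
    fix c assume c: "\<And>x. x \<in> V \<Longrightarrow> dot c x = 0"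
    have uwc: "dot c u = 0" "dot c w = 0"
      using c V_eq by (auto simp: vec.span_base)
    have "dot c x = dot (dot c y *s a + dot c z *s b) x" for x
      using arg_cong[OF coords[of x], of "dot c"]
      by (simp only: dot_linear uwc ab) (simp add: mult.commute)
    from this[of "axis _ 1"] show "c = dot c y *s a + dot c z *s b"
      unfolding dot_axis vec_eq_iff by (rule allI)
  qed
qed

lemma proj_point_scale:
  assumes "k \<noteq> 0"
  shows "proj_point (k *s x) = proj_point x"
  unfolding proj_point_def using vec.span_image_scale[of "{x}" "\<lambda>_. k"] assms by simp

lemma minors_combination:
  "minors (p *s a + q *s b) (r *s a + s *s b) = (p * s - q * r) *s minors a b"
  unfolding vec_eq_iff forall_6 by (simp add: minors_simps algebra_simps)

text \<open>
  The point \<open>klein V\<close> is defined by a description of \<open>V\<close> that has to be shown unique. Any pair of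
  equations of \<open>V\<close> is obtained from the pair \<open>a, b\<close> of the dual basis by a two-by-two matrix, which
  multiplies the minors by its determinant. The determinant is nonzero, for otherwise the equations
  would admit a solution in the span of \<open>y\<close> and \<open>z\<close>, which meets \<open>V\<close> only in \<open>0\<close>.
\<close>

lemma klein_line_of_equations:
  assumes V: "V \<in> Gr2" "V = line_of_equations c d"
  shows "klein V = proj_point (minors c d)"
proof -
  obtain a b y z where 1: "V = line_of_equations a b"
    "dot a y = 1" "dot a z = 0" "dot b y = 0" "dot b z = 1"
    "\<And>c. (\<And>x. x \<in> V \<Longrightarrow> dot c x = 0) \<Longrightarrow> c = dot c y *s a + dot c z *s b"
    using Gr2_dual_basis[OF V(1)] by blast
  have key: "proj_point (minors c d) = proj_point (minors a b)"
    if V: "V = line_of_equations c d" for c d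
  proof -
    have c: "c = dot c y *s a + dot c z *s b" and d: "d = dot d y *s a + dot d z *s b"
      by (rule 1(6); simp add: V line_of_equations_def)+
    let ?k = "dot c y * dot d z - dot c z * dot d y"
    have k_nz: "?k \<noteq> 0"
    proof
      assume k: "?k = 0"
      have mem: "m = 0 \<and> n = 0" if "m * dot c y + n * dot c z = 0" "m * dot d y + n * dot d z = 0" for m n
      proof -
        have "m *s y + n *s z \<in> line_of_equations c d"
          using that unfolding line_of_equations_def by (simp only: dot_linear mem_Collect_eq)
        then have "dot a (m *s y + n *s z) = 0" "dot b (m *s y + n *s z) = 0"
          unfolding V[symmetric] 1(1) by (simp_all add: line_of_equations_def)
        then show ?thesis
          unfolding dot_linear 1(2-5) by simp
      qed
      \<comment> \<open>A determinant of zero makes each column of the adjugate matrix a solution, up to sign.\<close>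
      have "dot c z = 0" "dot c y = 0"
        using mem[of "dot c z" "- dot c y"] k by (simp_all add: algebra_simps)
      moreover have "dot d z = 0" "dot d y = 0"
        using mem[of "dot d z" "- dot d y"] k by (simp_all add: algebra_simps)
      ultimately show False
        using mem[of 1 1] by simp
    qed
    have k: "minors c d = ?k *s minors a b"
      using minors_combination[of "dot c y" a "dot c z" b "dot d y" "dot d z"] c d by simp
    show ?thesis
      unfolding k using k_nz by (rule proj_point_scale)
  qed
  show ?thesis
    unfolding klein_def
  proof (rule the_equality)
    show "\<exists>a b. V = line_of_equations a b \<and> proj_point (minors c d) = proj_point (minors a b)"
      using V by blast
    show "P = proj_point (minors c d)"
      if "\<exists>a b. V = line_of_equations a b \<and> P = proj_point (minors a b)" for P
      using that key[OF V(2)] key by auto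
  qed
qed

section \<open>Planes that are graphs of matrices\<close>

text \<open>
  The graph of the linear map \<open>\<complex>\<^sup>2 \<rightarrow> \<complex>\<^sup>2\<close> that multiplies the row vector \<open>(x, y)\<close> from the right by the
  matrix with the rows \<open>(p, q)\<close> and \<open>(r, s)\<close>.
\<close>

definition graph_plane :: "complex \<Rightarrow> complex \<Rightarrow> complex \<Rightarrow> complex \<Rightarrow> (complex ^ 4) set" where
  "graph_plane p q r s = {vector [x, y, x * p + y * r, x * q + y * s] | x y. True}"

lemma mem_graph_plane:
  "X \<in> graph_plane p q r s \<longleftrightarrow>
    X $ 3 = X $ 1 * p + X $ 2 * r \<and> X $ 4 = X $ 1 * q + X $ 2 * s"
  unfolding graph_plane_def mem_Collect_eq vec_eq_iff forall_4 by auto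

lemma graph_plane_equations:
  "graph_plane p q r s = line_of_equations (vector [p, r, - 1, 0]) (vector [q, s, 0, - 1])"
  unfolding line_of_equations_def set_eq_iff mem_graph_plane mem_Collect_eq
  by (auto simp: sum_4 algebra_simps)

lemma graph_plane_in_Gr2: "graph_plane p q r s \<in> Gr2"
proof -
  let ?u = "vector [1, 0, p, q] :: complex ^ 4" and ?w = "vector [0, 1, r, s] :: complex ^ 4"
  have "vec.subspace (graph_plane p q r s)"
    by (rule vec.subspaceI) (auto simp: mem_graph_plane algebra_simps)
  moreover have "vec.dim (graph_plane p q r s) = 2"
  proof (rule vec.dim_unique[of "{?u, ?w}"])
    show "{?u, ?w} \<subseteq> graph_plane p q r s"
      by (auto simp: mem_graph_plane)
    have "x \<in> vec.span {?u, ?w}" if "x \<in> graph_plane p q r s" for x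
    proof -
      have "x = x $ 1 *s ?u + x $ 2 *s ?w"
        using that unfolding mem_graph_plane vec_eq_iff forall_4 by simp
      then show ?thesis
        by (metis insertCI vec.span_add vec.span_base vec.span_scale)
    qed
    then show "graph_plane p q r s \<subseteq> vec.span {?u, ?w}" by blast
    have ne: "?u \<noteq> ?w" "?w \<noteq> 0" "\<And>k. ?u \<noteq> k *s ?w"
      unfolding vec_eq_iff forall_4 by simp_all
    then show "vec.independent {?u, ?w}"
      by (auto simp: vec.independent_insert vec.span_singleton)
    show "card {?u, ?w} = 2"
      using ne by simp
  qed
  ultimately show ?thesis
    by (simp add: Gr2_def)
qed

text \<open>
  Normalized by \<open>\<xi>\<^sub>6 = 1\<close>; then \<open>\<xi>\<^sub>1\<close> is the determinant of the matrix and \<open>\<xi>\<^sub>2, \<dots>, \<xi>\<^sub>5\<close> are its entries up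
  to order and sign. So the entries are affine coordinates on the chart \<open>\<xi>\<^sub>6 \<noteq> 0\<close> of the Klein quadric.
\<close>

definition klein_vector :: "complex \<Rightarrow> complex \<Rightarrow> complex \<Rightarrow> complex \<Rightarrow> complex ^ 6" where
  "klein_vector p q r s = vector [p * s - r * q, q, - p, s, - r, 1]"

lemma klein_graph_plane: "klein (graph_plane p q r s) = proj_point (klein_vector p q r s)"
proof -
  have "minors (vector [p, r, - 1, 0]) (vector [q, s, 0, - 1]) = klein_vector p q r s"
    unfolding vec_eq_iff forall_6 by (simp add: minors_simps klein_vector_def)
  then show ?thesis
    using klein_line_of_equations[OF graph_plane_in_Gr2 graph_plane_equations] by simp
qed

text \<open>
  The minor \<open>\<xi>\<^sub>6\<close> is the determinant of the two equations in the unknowns \<open>x\<^sub>3\<close> and \<open>x\<^sub>4\<close>. When it does not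
  vanish, Cramer's rule solves for these unknowns, and the coefficients of the solution are quotients
  of the other minors by \<open>\<xi>\<^sub>6\<close>.
\<close>

lemma graph_plane_of_klein:
  assumes V: "V \<in> Gr2" and nz: "coord_nonzero 6 (klein V)"
  defines "c \<equiv> \<lambda>j. affine_coord 6 j (klein V)"
  shows "V = graph_plane (- c 3) (c 2) (- c 5) (c 4)"
proof -
  obtain a b where ab: "V = line_of_equations a b"
    using Gr2_dual_basis[OF V] by blast
  let ?m = "\<lambda>h k. a $ h * b $ k - a $ k * b $ h"
  have k: "klein V = proj_point (minors a b)"
    using V ab by (rule klein_line_of_equations)
  with nz have m: "?m 3 4 \<noteq> 0"
    by (simp add: minors_simps)
  then have c: "c 2 = ?m 1 3 / ?m 3 4" "c 3 = ?m 1 4 / ?m 3 4"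
      "c 4 = ?m 2 3 / ?m 3 4" "c 5 = ?m 2 4 / ?m 3 4"
    unfolding c_def k by (subst affine_coord_proj_point; simp add: minors_simps)+
  show ?thesis
    unfolding ab set_eq_iff
  proof
    fix x :: "complex ^ 4"
    let ?A = "a $ 1 * x $ 1 + a $ 2 * x $ 2 + a $ 3 * x $ 3 + a $ 4 * x $ 4"
    let ?B = "b $ 1 * x $ 1 + b $ 2 * x $ 2 + b $ 3 * x $ 3 + b $ 4 * x $ 4"
    let ?u = "?m 3 4 * x $ 3 + x $ 1 * ?m 1 4 + x $ 2 * ?m 2 4"
    let ?v = "?m 3 4 * x $ 4 - x $ 1 * ?m 1 3 - x $ 2 * ?m 2 3"
    \<comment> \<open>Elimination of one unknown at a time, and the inverse of this step up to the factor \<open>\<xi>\<^sub>6\<close>.\<close>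
    have "?u = b $ 4 * ?A - a $ 4 * ?B" "?v = a $ 3 * ?B - b $ 3 * ?A"
      "?m 3 4 * ?A = a $ 3 * ?u + a $ 4 * ?v" "?m 3 4 * ?B = b $ 3 * ?u + b $ 4 * ?v"
      by (simp_all add: algebra_simps)
    then have "?A = 0 \<and> ?B = 0 \<longleftrightarrow> ?u = 0 \<and> ?v = 0"
      using m by (metis add_0 diff_zero mult_eq_0_iff mult_zero_right)
    moreover have "x \<in> line_of_equations a b \<longleftrightarrow> ?A = 0 \<and> ?B = 0"
      by (simp add: line_of_equations_def sum_4)
    moreover have "x $ 3 = x $ 1 * - c 3 + x $ 2 * - c 5 \<longleftrightarrow> ?u = 0"
      unfolding c using m by (simp add: divide_simps) algebra
    moreover have "x $ 4 = x $ 1 * c 2 + x $ 2 * c 4 \<longleftrightarrow> ?v = 0"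
      unfolding c using m by (simp add: divide_simps) algebra
    ultimately show "x \<in> line_of_equations a b \<longleftrightarrow>
        x \<in> graph_plane (- c 3) (c 2) (- c 5) (c 4)"
      by (simp add: mem_graph_plane)
  qed
qed

section \<open>Continuous maps into projective space\<close>

lemma topspace_proj_topology: "topspace proj_topology = (proj_space :: (complex ^ 'n) set set)"
proof -
  have "{x :: complex ^ 'n. x \<noteq> 0 \<and> proj_point x \<in> proj_space} = - {0}"
    using proj_point_in_proj_space by auto
  then have "openin proj_topology (proj_space :: (complex ^ 'n) set set)"
    by (simp add: openin_proj_topology open_Compl)
  then show ?thesis
    unfolding topspace_def by (auto simp: openin_proj_topology)
qed

lemma continuous_map_proj_point:
  fixes x :: "'a::topological_space \<Rightarrow> complex ^ 'n"
  assumes "continuous_on D x" and "\<And>v. v \<in> D \<Longrightarrow> x v \<noteq> 0"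
  shows "continuous_map (top_of_set D) proj_topology (\<lambda>v. proj_point (x v))"
  unfolding continuous_map_def
proof (intro conjI allI impI)
  show "(\<lambda>v. proj_point (x v)) \<in> topspace (top_of_set D) \<rightarrow> topspace proj_topology"
    using assms(2) by (auto simp: topspace_proj_topology intro: proj_point_in_proj_space)
  fix U :: "(complex ^ 'n) set set"
  assume "openin proj_topology U"
  then have "openin (top_of_set D) (D \<inter> x -` {x. x \<noteq> 0 \<and> proj_point x \<in> U})"
    using assms(1) by (intro continuous_openin_preimage_gen) (auto simp: openin_proj_topology)
  moreover have "D \<inter> x -` {x. x \<noteq> 0 \<and> proj_point x \<in> U} =
      {v \<in> topspace (top_of_set D). proj_point (x v) \<in> U}"
    using assms(2) by auto
  ultimately show "openin (top_of_set D) {v \<in> topspace (top_of_set D). proj_point (x v) \<in> U}"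
    by simp
qed

text \<open>
  The topology of projective space is a quotient topology, so it suffices that the quotient of two
  homogeneous coordinates is continuous on the vectors where the denominator does not vanish.
\<close>

lemma continuous_on_affine_coord:
  fixes g :: "'a::topological_space \<Rightarrow> (complex ^ 'n) set"
  assumes g: "continuous_map (top_of_set D) proj_topology g"
    and nz: "\<And>v. v \<in> D \<Longrightarrow> coord_nonzero i (g v)"
  shows "continuous_on D (\<lambda>v. affine_coord i j (g v))"
  unfolding continuous_on_open_invariant
proof (intro allI impI)
  fix W :: "complex set"
  assume "open W"
  let ?U = "{L \<in> proj_space. coord_nonzero i L \<and> affine_coord i j L \<in> W}"
  have eq: "{x. x \<noteq> 0 \<and> proj_point x \<in> ?U} =
      {x :: complex ^ 'n. x $ i \<noteq> 0} \<inter> (\<lambda>x. x $ j / x $ i) -` W"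
    by (auto simp: affine_coord_proj_point intro!: proj_point_in_proj_space)
  have "open {x :: complex ^ 'n. x $ i \<noteq> 0}"
    by (intro open_Collect_neq continuous_intros)
  then have "open ({x :: complex ^ 'n. x $ i \<noteq> 0} \<inter> (\<lambda>x. x $ j / x $ i) -` W)"
    using \<open>open W\<close> by (intro continuous_open_preimage continuous_intros) auto
  then have "openin proj_topology ?U"
    unfolding openin_proj_topology eq by auto
  then have op: "openin (top_of_set D) {v \<in> D. g v \<in> ?U}"
    using g by (auto simp: continuous_map_def)
  have "{v \<in> D. g v \<in> ?U} = (\<lambda>v. affine_coord i j (g v)) -` W \<inter> D"
    using nz g by (auto simp: continuous_map_def topspace_proj_topology)
  with op show "\<exists>A. open A \<and> A \<inter> D = (\<lambda>v. affine_coord i j (g v)) -` W \<inter> D"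
    by (auto simp: openin_open)
qed

section \<open>Curves of graphs\<close>

lemma Gr2_curve_iff:
  "Gr2_curve D \<gamma> \<longleftrightarrow>
    (\<forall>v\<in>D. \<gamma> v \<in> Gr2) \<and> continuous_map (top_of_set D) proj_topology (klein \<circ> \<gamma>)"
proof
  assume "Gr2_curve D \<gamma>"
  then have c: "continuous_map (top_of_set D) (pullback_topology Gr2 klein proj_topology) \<gamma>"
    by (simp add: Gr2_curve_def Gr2_topology_def)
  have "continuous_map (pullback_topology Gr2 klein proj_topology) proj_topology (id \<circ> klein)"
    by (rule continuous_map_pullback) simp
  then have "continuous_map (top_of_set D) proj_topology (klein \<circ> \<gamma>)"
    using continuous_map_compose[OF c] by simp
  moreover have "\<gamma> v \<in> Gr2" if "v \<in> D" for v
    using c that by (auto simp: continuous_map_def topspace_pullback_topology)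
  ultimately show "(\<forall>v\<in>D. \<gamma> v \<in> Gr2) \<and> continuous_map (top_of_set D) proj_topology (klein \<circ> \<gamma>)"
    by blast
next
  assume "(\<forall>v\<in>D. \<gamma> v \<in> Gr2) \<and> continuous_map (top_of_set D) proj_topology (klein \<circ> \<gamma>)"
  then show "Gr2_curve D \<gamma>"
    unfolding Gr2_curve_def Gr2_topology_def
    by (intro continuous_map_pullback') auto
qed

lemma Gr2_curve_graph_plane:
  assumes "continuous_on D p" "continuous_on D q" "continuous_on D r" "continuous_on D s"
    and \<gamma>: "\<And>v. v \<in> D \<Longrightarrow> \<gamma> v = graph_plane (p v) (q v) (r v) (s v)"
  shows "Gr2_curve D \<gamma>"
  unfolding Gr2_curve_iff
proof (intro conjI ballI)
  show "\<gamma> v \<in> Gr2" if "v \<in> D" for v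
    using \<gamma>[OF that] graph_plane_in_Gr2 by simp
  let ?x = "\<lambda>v. klein_vector (p v) (q v) (r v) (s v)"
  have "\<forall>i. continuous_on D (\<lambda>v. ?x v $ i)"
    unfolding forall_6 klein_vector_def by (simp, intro conjI continuous_intros assms)
  then have "continuous_on D (\<lambda>v. \<chi> i. ?x v $ i)"
    by (intro continuous_on_vec_lambda) blast
  then have "continuous_on D ?x"
    by simp
  moreover have "?x v \<noteq> 0" for v
    by (simp add: klein_vector_def vec_eq_iff forall_6)
  ultimately have "continuous_map (top_of_set D) proj_topology (\<lambda>v. proj_point (?x v))"
    by (intro continuous_map_proj_point)
  then show "continuous_map (top_of_set D) proj_topology (klein \<circ> \<gamma>)"
    by (rule continuous_map_eq) (simp add: \<gamma> klein_graph_plane)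
qed

lemma Gr2_holomorphic_curve_graph_plane:
  assumes hol: "p holomorphic_on D" "q holomorphic_on D" "r holomorphic_on D" "s holomorphic_on D"
    and \<gamma>: "\<And>v. v \<in> D \<Longrightarrow> \<gamma> v = graph_plane (p v) (q v) (r v) (s v)"
  shows "Gr2_holomorphic_curve D \<gamma>"
proof -
  let ?x = "\<lambda>v. klein_vector (p v) (q v) (r v) (s v)"
  have curve: "Gr2_curve D \<gamma>"
    by (rule Gr2_curve_graph_plane[OF hol[THEN holomorphic_on_imp_continuous_on] \<gamma>])
  have "\<forall>i. (\<lambda>v. ?x v $ i) holomorphic_on D"
    unfolding forall_6 klein_vector_def by (simp, intro conjI holomorphic_intros hol)
  then have x: "(\<lambda>v. ?x v $ i) holomorphic_on D" for i
    by blast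
  have "(\<lambda>v. affine_coord i j ((klein \<circ> \<gamma>) v)) holomorphic_on
      {v \<in> D. coord_nonzero i ((klein \<circ> \<gamma>) v)}" for i j
  proof (rule holomorphic_transform)
    let ?D = "{v \<in> D. coord_nonzero i ((klein \<circ> \<gamma>) v)}"
    have nz: "?x v $ i \<noteq> 0" if "v \<in> ?D" for v
      using that by (auto simp: \<gamma> klein_graph_plane)
    then show "(\<lambda>v. ?x v $ j / ?x v $ i) holomorphic_on ?D"
      by (intro holomorphic_on_divide holomorphic_on_subset[OF x]) auto
    show "?x v $ j / ?x v $ i = affine_coord i j ((klein \<circ> \<gamma>) v)" if "v \<in> ?D" for v
      using that nz by (auto simp: \<gamma> klein_graph_plane affine_coord_proj_point)
  qed
  with curve show ?thesis
    by (simp add: Gr2_holomorphic_curve_def Gr2_curve_iff proj_holomorphic_on_def)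
qed

text \<open>
  The sixth homogeneous coordinate never vanishes on graphs, so the chart with this denominator
  covers all of \<open>D\<close>, and up to sign the entries of the matrix are among its coordinates.
\<close>

lemma Gr2_holomorphic_curve_graph_planeD:
  assumes hol: "Gr2_holomorphic_curve D \<gamma>"
    and \<gamma>: "\<And>v. v \<in> D \<Longrightarrow> \<gamma> v = graph_plane (p v) (q v) (r v) (s v)"
  shows "p holomorphic_on D" "q holomorphic_on D" "r holomorphic_on D" "s holomorphic_on D"
proof -
  have k: "klein (\<gamma> v) = proj_point (klein_vector (p v) (q v) (r v) (s v))" if "v \<in> D" for v
    using that by (simp add: \<gamma> klein_graph_plane)
  have 1: "klein_vector a b c d $ 6 = 1" for a b c d
    by (simp add: klein_vector_def)
  have "{v \<in> D. coord_nonzero 6 ((klein \<circ> \<gamma>) v)} = D"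
    using k 1 by auto
  moreover have "\<forall>j. (\<lambda>v. affine_coord 6 j ((klein \<circ> \<gamma>) v)) holomorphic_on
      {v \<in> D. coord_nonzero 6 ((klein \<circ> \<gamma>) v)}"
    using hol unfolding Gr2_holomorphic_curve_def proj_holomorphic_on_def by blast
  ultimately have "(\<lambda>v. affine_coord 6 j ((klein \<circ> \<gamma>) v)) holomorphic_on D" for j
    by simp
  then have x: "(\<lambda>v. klein_vector (p v) (q v) (r v) (s v) $ j) holomorphic_on D" for j
    by (rule holomorphic_transform) (simp add: k 1 affine_coord_proj_point)
  show "q holomorphic_on D" "s holomorphic_on D"
    using x[of 2] x[of 4] by (simp_all add: klein_vector_def)
  show "p holomorphic_on D" "r holomorphic_on D"
    using holomorphic_on_minus[OF x[of 3]] holomorphic_on_minus[OF x[of 5]]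
    by (simp_all add: klein_vector_def)
qed

section \<open>Complexified quaternions as complex two-by-two matrices\<close>

text \<open>
  The complex coordinates of a quaternion: \<open>x = fst_part x + snd_part x j\<close>.
\<close>

definition fst_part :: "quat \<Rightarrow> complex" where
  "fst_part x = Complex (q_re x) (q_i x)"

definition snd_part :: "quat \<Rightarrow> complex" where
  "snd_part x = Complex (q_j x) (q_k x)"

lemma bounded_linear_fst_part: "bounded_linear fst_part"
proof (rule bounded_linear_intro[of _ 1])
  fix x
  have "(norm (fst_part x))\<^sup>2 \<le> (norm x)\<^sup>2"
    by (simp add: fst_part_def cmod_power2 quat_norm_sq)
  then show "norm (fst_part x) \<le> norm x * 1"
    by (simp add: power2_le_iff_abs_le)
qed (simp_all add: fst_part_def complex_eq_iff)

lemma bounded_linear_snd_part: "bounded_linear snd_part"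
proof (rule bounded_linear_intro[of _ 1])
  fix x
  have "(norm (snd_part x))\<^sup>2 \<le> (norm x)\<^sup>2"
    by (simp add: snd_part_def cmod_power2 quat_norm_sq)
  then show "norm (snd_part x) \<le> norm x * 1"
    by (simp add: power2_le_iff_abs_le)
qed (simp_all add: snd_part_def complex_eq_iff)

text \<open>
  The isomorphism of \<open>\<H> \<otimes> \<complex>\<close> with the algebra of complex two-by-two matrices. Identify \<open>\<H>\<close> with \<open>\<complex>\<^sup>2\<close> by
  \<open>(x, y) \<mapsto> x + y j\<close>, a left vector space over \<open>\<complex>\<close>. Right multiplication by a quaternion is then
  complex linear, and \<open>\<surd>(-1)\<close> acts as left multiplication by \<open>i\<close>, which is the scalar \<open>i\<close>. The entries
  below are those of the matrix that acts on the row \<open>(x, y)\<close> from the right; see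
  \<open>quat_of_pair_mult_mat\<close>.
\<close>

definition mat11 :: "quat \<times> quat \<Rightarrow> complex" where
  "mat11 x = fst_part (fst x) + \<i> * fst_part (snd x)"

definition mat12 :: "quat \<times> quat \<Rightarrow> complex" where
  "mat12 x = snd_part (fst x) + \<i> * snd_part (snd x)"

definition mat21 :: "quat \<times> quat \<Rightarrow> complex" where
  "mat21 x = - (cnj (snd_part (fst x)) + \<i> * cnj (snd_part (snd x)))"

definition mat22 :: "quat \<times> quat \<Rightarrow> complex" where
  "mat22 x = cnj (fst_part (fst x)) + \<i> * cnj (fst_part (snd x))"

lemmas mat_defs = mat11_def mat12_def mat21_def mat22_def

text \<open>
  The inverse isomorphism. With \<open>F\<^sub>1 = a + b j\<close> and \<open>F\<^sub>2 = c + d j\<close> one has \<open>p = a + i c\<close> and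
  \<open>cnj s = a - i c\<close>, likewise \<open>q = b + i d\<close> and \<open>- cnj r = b - i d\<close>.
\<close>

definition quats_of_mat :: "complex \<times> complex \<times> complex \<times> complex \<Rightarrow> quat \<times> quat" where
  "quats_of_mat = (\<lambda>(p, q, r, s).
    (quat_of_pair ((p + cnj s) / 2) ((q - cnj r) / 2),
     quat_of_pair (- \<i> * ((p - cnj s) / 2)) (- \<i> * ((q + cnj r) / 2))))"

lemma bounded_linear_mat:
  "bounded_linear mat11" "bounded_linear mat12" "bounded_linear mat21" "bounded_linear mat22"
proof -
  note parts = bounded_linear_fst_part bounded_linear_snd_part
  note comps = parts[THEN bounded_linear_compose, OF bounded_linear_fst]
    parts[THEN bounded_linear_compose, OF bounded_linear_snd]
  note cnjs = comps[THEN bounded_linear_compose[OF bounded_linear_cnj]]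
  note intros = bounded_linear_add bounded_linear_minus comps cnjs
    comps[THEN bounded_linear_const_mult] cnjs[THEN bounded_linear_const_mult]
  show "bounded_linear mat11" "bounded_linear mat12" "bounded_linear mat21" "bounded_linear mat22"
    unfolding mat_defs[abs_def] by (intro intros)+
qed

lemma bounded_linear_quats_of_mat: "bounded_linear quats_of_mat"
  unfolding linear_conv_bounded_linear[symmetric]
  by (rule linearI; clarsimp simp: quats_of_mat_def quat_of_pair_Quat quat_eq_iff; simp add: field_simps)

text \<open>
  Complex linearity of the isomorphism; through it the Cauchy-Riemann equation of slice regularity
  becomes the usual one for the matrix entries.
\<close>

lemma mat_sqrt_minus_one_times:
  "mat11 (sqrt_minus_one_times x) = \<i> * mat11 x" "mat12 (sqrt_minus_one_times x) = \<i> * mat12 x"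
  "mat21 (sqrt_minus_one_times x) = \<i> * mat21 x" "mat22 (sqrt_minus_one_times x) = \<i> * mat22 x"
  by (simp_all add: mat_defs sqrt_minus_one_times_def fst_part_def snd_part_def complex_eq_iff)

lemma quats_of_mat_times_i:
  "quats_of_mat (\<i> * p, \<i> * q, \<i> * r, \<i> * s) = sqrt_minus_one_times (quats_of_mat (p, q, r, s))"
  by (simp add: quats_of_mat_def quat_of_pair_Quat quat_eq_iff sqrt_minus_one_times_def field_simps)

lemma quats_of_mat_inverse: "quats_of_mat (mat11 x, mat12 x, mat21 x, mat22 x) = x"
  by (cases x) (simp add: quats_of_mat_def mat_defs quat_of_pair_Quat quat_eq_iff
      fst_part_def snd_part_def)

lemma mat_quats_of_mat:
  "mat11 (quats_of_mat (p, q, r, s)) = p" "mat12 (quats_of_mat (p, q, r, s)) = q"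
  "mat21 (quats_of_mat (p, q, r, s)) = r" "mat22 (quats_of_mat (p, q, r, s)) = s"
  by (simp_all add: quats_of_mat_def mat_defs quat_of_pair_Quat complex_eq_iff
      fst_part_def snd_part_def) (simp_all add: field_simps)

lemma quat_of_pair_mult_mat:
  "quat_of_pair x y * fst F + quat_of_complex \<i> * (quat_of_pair x y * snd F) =
    quat_of_pair (x * mat11 F + y * mat21 F) (x * mat12 F + y * mat22 F)"
  by (simp add: quat_of_pair_Quat quat_of_complex_def quat_eq_iff mat_defs fst_part_def
      snd_part_def algebra_simps)

section \<open>The twistor transform as a graph\<close>

text \<open>
  For \<open>p = x + y j\<close> the point \<open>[x, y, x v, y v]\<close> projects to the class of \<open>(p, v p)\<close>, that is to the
  quaternion \<open>w = p\<^sup>-\<^sup>1 v p = Re v + I Im v\<close> with the imaginary unit \<open>I = p\<^sup>-\<^sup>1 i p\<close>. Hence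
  \<open>p f(w) = p F\<^sub>1(v) + i p F\<^sub>2(v)\<close>, which is the action of the matrix of \<open>F(v)\<close> on the row \<open>(x, y)\<close>: the
  conjugation by \<open>p\<close> has disappeared, and the lift is linear in \<open>(x, y)\<close>.
\<close>

lemma twistor_lift_l_line:
  assumes F: "slice_function_of D F f" and v: "v \<in> D" and D: "D \<subseteq> upper_half_plane"
    and st: "(x, y) \<noteq> (0, 0)"
  shows "twistor_lift D f (proj_point (vector [x, y, x * v, y * v])) =
    proj_point (vector [x, y, x * mat11 (F v) + y * mat21 (F v), x * mat12 (F v) + y * mat22 (F v)])"
proof -
  let ?X = "vector [x, y, x * v, y * v] :: complex ^ 4"
  define p where "p = quat_of_pair x y"
  have "p \<noteq> 0"
    using st unfolding p_def by (auto simp: quat_of_pair_Quat quat_eq_iff complex_eq_iff)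
  define I where "I = inverse p * quat_of_complex \<i> * p"
  have pI: "p * I = quat_of_complex \<i> * p"
    using \<open>p \<noteq> 0\<close> by (simp add: I_def mult.assoc[symmetric])
  have "I\<^sup>2 = inverse p * quat_of_complex \<i> * (p * I)"
    by (simp add: I_def power2_eq_square mult.assoc)
  also have "\<dots> = inverse p * (quat_of_complex \<i> * quat_of_complex \<i>) * p"
    by (simp only: pI mult.assoc)
  also have "quat_of_complex \<i> * quat_of_complex \<i> = - 1"
    by (simp add: quat_of_complex_def quat_eq_iff)
  finally have I: "I \<in> imag_units"
    using \<open>p \<noteq> 0\<close> by (simp add: imag_units_def)
  define w where "w = of_real (Re v) + I * of_real (Im v)"
  have X: "?X \<noteq> 0"
    using st by (auto simp: vec_eq_iff forall_4)
  have "p * w = quat_of_complex v * p"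
    unfolding w_def distrib_left mult.assoc[symmetric] pI
    by (simp add: of_real_def quat_of_complex_def quat_eq_iff algebra_simps)
  moreover have "quat_of_complex v * p = quat_of_pair (x * v) (y * v)"
    unfolding p_def quat_of_pair_scale[symmetric] by (simp add: mult.commute)
  ultimately have "HP_class (quat_of_pair x y, quat_of_pair (x * v) (y * v)) = HP_class (p * 1, p * w)"
    by (simp add: p_def)
  also have "\<dots> = HP_class (1, w)"
    using \<open>p \<noteq> 0\<close> by (rule HP_class_scale)
  finally have tw: "twistor_proj (proj_point ?X) = HP_of_quat w"
    using X by (simp add: twistor_proj_point HP_of_quat_def)
  have "inj HP_of_quat"
    by (simp add: inj_def HP_of_quat_inject)
  then have inv: "inv HP_of_quat (twistor_proj (proj_point ?X)) = w"
    by (simp add: tw)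
  have "w \<in> circularization D"
    unfolding circularization_def w_def using v I by force
  moreover have "v \<in> upper_half_plane"
    using v D by blast
  then have "proj_point ?X \<in> Q_plus"
    unfolding Q_plus_def using X st by (intro CollectI exI[of _ ?X]) auto
  ultimately have dom: "proj_point ?X \<in> twistor_domain D"
    by (simp add: twistor_domain_def tw)
  have "f w = fst (F v) + I * snd (F v)"
    using F I v unfolding slice_function_of_def w_def by simp
  then have "p * f w = p * fst (F v) + quat_of_complex \<i> * (p * snd (F v))"
    by (simp only: distrib_left mult.assoc[symmetric] pI)
  then have "quat_of_pair (x * mat11 (F v) + y * mat21 (F v)) (x * mat12 (F v) + y * mat22 (F v)) =
      quat_of_pair (?X $ 1) (?X $ 2) * f (inv HP_of_quat (twistor_proj (proj_point ?X)))"
    by (simp add: inv p_def quat_of_pair_mult_mat)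
  from twistor_lift_point[where X="?X" and f=f, OF dom this] show ?thesis
    by simp
qed

lemma twistor_transform_eq_graph_plane:
  assumes F: "slice_function_of D F f" and v: "v \<in> D" and D: "D \<subseteq> upper_half_plane"
  shows "twistor_transform D f v =
    graph_plane (mat11 (F v)) (mat12 (F v)) (mat21 (F v)) (mat22 (F v))"
proof -
  let ?Y = "\<lambda>x y. vector [x, y, x * mat11 (F v) + y * mat21 (F v),
    x * mat12 (F v) + y * mat22 (F v)] :: complex ^ 4"
  have scale: "c *s ?Y x y = ?Y (c * x) (c * y)" for c x y
    by (simp add: vec_eq_iff forall_4 algebra_simps)
  have "l_line v = (\<lambda>(x, y). proj_point (vector [x, y, x * v, y * v])) ` (- {(0, 0)})"
    unfolding l_line_def image_def by auto
  then have "twistor_lift D f ` l_line v = (\<lambda>(x, y). proj_point (?Y x y)) ` (- {(0, 0)})"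
    by (simp add: image_image case_prod_beta twistor_lift_l_line[OF F v D])
  then have "twistor_transform D f v = (\<Union>(x, y)\<in>- {(0, 0)}. proj_point (?Y x y))"
    using v by (simp add: twistor_transform_def)
  also have "\<dots> = {?Y x y | x y. True}"
  proof (intro subset_antisym subsetI)
    fix X assume "X \<in> (\<Union>(x, y)\<in>- {(0, 0)}. proj_point (?Y x y))"
    then obtain x y where "X \<in> proj_point (?Y x y)"
      by (elim UN_E) (simp only: case_prod_beta)
    then show "X \<in> {?Y x y | x y. True}"
      unfolding proj_point_eq image_iff scale by blast
  next
    fix X assume "X \<in> {?Y x y | x y. True}"
    then obtain x y where X: "X = ?Y x y" by blast
    \<comment> \<open>The zero vector belongs to every point of the line, for instance to that with \<open>(x, y) = (1, 0)\<close>.\<close>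
    obtain x' y' where ne: "(x', y') \<in> - {(0, 0) :: complex \<times> complex}"
      and "X \<in> proj_point (?Y x' y')"
    proof (cases "(x, y) = (0, 0)")
      case True
      then have "X = 0 *s ?Y 1 0"
        unfolding scale X by simp
      then have "X \<in> proj_point (?Y 1 0)"
        unfolding proj_point_eq by (rule range_eqI)
      then show thesis
        by (intro that[of 1 0]) simp_all
    next
      case False
      have "X \<in> proj_point (?Y x y)"
        unfolding X proj_point_def by (rule vec.span_base) (rule insertI1)
      with False show thesis
        by (intro that[of x y]) simp_all
    qed
    then show "X \<in> (\<Union>(x, y)\<in>- {(0, 0)}. proj_point (?Y x y))"
      by (intro UN_I[OF ne]) (simp only: case_prod_conv)
  qed
  finally show ?thesis
    by (simp only: graph_plane_def)
qed

section \<open>Slice functions from stem functions\<close>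

lemma imag_units_iff: "I \<in> imag_units \<longleftrightarrow> q_re I = 0 \<and> norm I = 1"
proof -
  have n: "norm I = 1 \<longleftrightarrow> (q_re I)\<^sup>2 + (q_i I)\<^sup>2 + (q_j I)\<^sup>2 + (q_k I)\<^sup>2 = 1"
    unfolding quat_norm_sq[symmetric] by (simp add: abs_square_eq_1)
  have sq: "I\<^sup>2 = - 1 \<longleftrightarrow> (q_re I)\<^sup>2 - (q_i I)\<^sup>2 - (q_j I)\<^sup>2 - (q_k I)\<^sup>2 = - 1 \<and>
      q_re I * q_i I = 0 \<and> q_re I * q_j I = 0 \<and> q_re I * q_k I = 0"
    by (auto simp: quat_eq_iff power2_eq_square)
  have "q_re I = 0" if "I\<^sup>2 = - 1"
  proof (rule ccontr)
    assume "q_re I \<noteq> 0"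
    with that have "(q_re I)\<^sup>2 = - 1"
      unfolding sq by auto
    then show False
      using zero_le_power2[of "q_re I"] by linarith
  qed
  then show ?thesis
    unfolding imag_units_def n mem_Collect_eq by (auto simp only: sq) (simp_all add: algebra_simps)
qed

text \<open>
  The decomposition of a nonreal quaternion as \<open>\<alpha> + I \<beta>\<close> becomes unique with \<open>\<beta> > 0\<close>: the number \<open>\<beta>\<close> is
  the norm of the imaginary part, and \<open>I\<close> its direction. Since \<open>D\<close> lies in the upper half plane, this is
  the only decomposition that matters.
\<close>

definition slice_extension :: "(complex \<Rightarrow> quat \<times> quat) \<Rightarrow> quat \<Rightarrow> quat" where
  "slice_extension F x =
    (let y = x - of_real (q_re x); z = Complex (q_re x) (norm y)
     in fst (F z) + (y /\<^sub>R norm y) * snd (F z))"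

lemma slice_function_of_slice_extension:
  assumes "D \<subseteq> upper_half_plane"
  shows "slice_function_of D F (slice_extension F)"
  unfolding slice_function_of_def
proof (intro allI ballI impI)
  fix a b I
  assume I: "I \<in> imag_units" and ab: "Complex a b \<in> D"
  then have b: "b > 0"
    using assms by (auto simp: upper_half_plane_def)
  have I': "q_re I = 0" "norm I = 1"
    using I by (simp_all add: imag_units_iff)
  then have re: "q_re (of_real a + I * of_real b) = a"
    by (simp add: of_real_def)
  have "norm (I * of_real b) = b"
    using I' b by (simp add: norm_mult)
  moreover have "I * of_real b /\<^sub>R b = I"
    using b by (simp add: of_real_def)
  ultimately show "slice_extension F (of_real a + I * of_real b) =
      fst (F (Complex a b)) + I * snd (F (Complex a b))"
    unfolding slice_extension_def re by (simp only: Let_def add_diff_cancel_left')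
qed

section \<open>Slice regularity of the stem function\<close>

text \<open>
  The Cauchy-Riemann equation says that the derivative \<open>F' z\<close> intertwines \<open>\<i>\<close> with \<open>\<surd>(-1)\<close>. Composed with
  a map that takes \<open>\<surd>(-1)\<close> back to \<open>\<i>\<close>, it is multiplication by a complex number.
\<close>

lemma holomorphic_on_complex_linear_image:
  fixes T :: "quat \<times> quat \<Rightarrow> complex"
  assumes T: "bounded_linear T" "\<And>x. T (sqrt_minus_one_times x) = \<i> * T x"
    and D: "open D"
    and F: "\<And>z. z \<in> D \<Longrightarrow> (F has_derivative blinfun_apply (F' z)) (at z)"
    and CR: "\<And>z. z \<in> D \<Longrightarrow>
      blinfun_apply (F' z) 1 + sqrt_minus_one_times (blinfun_apply (F' z) \<i>) = 0"
  shows "(\<lambda>z. T (F z)) holomorphic_on D"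
  unfolding holomorphic_on_open[OF D]
proof
  fix z assume z: "z \<in> D"
  interpret T: bounded_linear T by fact
  have "T (F' z 1) + \<i> * T (F' z \<i>) = 0"
    using arg_cong[OF CR[OF z], of T] by (simp add: T.add T(2) T.zero)
  then have i: "T (F' z \<i>) = \<i> * T (F' z 1)"
    by (simp add: complex_eq_iff)
  have "T (F' z h) = T (F' z 1) * h" for h
  proof -
    have "h = Re h *\<^sub>R 1 + Im h *\<^sub>R \<i>"
      by (simp add: complex_eq_iff)
    from arg_cong[OF this, of "\<lambda>h. T (F' z h)"]
    have "T (F' z h) = Re h *\<^sub>R T (F' z 1) + Im h *\<^sub>R T (F' z \<i>)"
      by (simp only: blinfun.add_right blinfun.scaleR_right T.add T.scaleR)
    then show ?thesis
      unfolding i by (simp add: complex_eq_iff algebra_simps)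
  qed
  then have "(\<lambda>h. T (F' z h)) = (*) (T (F' z 1))"
    by (rule ext)
  with T.has_derivative[OF F[OF z]]
  have "((\<lambda>z. T (F z)) has_field_derivative T (F' z 1)) (at z)"
    unfolding has_field_derivative_def by (simp only:)
  then show "\<exists>d. ((\<lambda>z. T (F z)) has_field_derivative d) (at z)" ..
qed

text \<open>
  The inverse isomorphism turns the complex derivatives of the matrix entries into a derivative of
  \<open>F\<close>. It is continuous because the derivative of a holomorphic function is holomorphic.
\<close>

lemma slice_regular_if_mat_holomorphic:
  assumes D: "open D" and F: "slice_function_of D F f"
    and hol: "(\<lambda>z. mat11 (F z)) holomorphic_on D" "(\<lambda>z. mat12 (F z)) holomorphic_on D"
      "(\<lambda>z. mat21 (F z)) holomorphic_on D" "(\<lambda>z. mat22 (F z)) holomorphic_on D"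
  shows "slice_regular D f"
proof -
  define d where "d z = (deriv (\<lambda>z. mat11 (F z)) z, deriv (\<lambda>z. mat12 (F z)) z,
    deriv (\<lambda>z. mat21 (F z)) z, deriv (\<lambda>z. mat22 (F z)) z)" for z
  define L where "L = (\<lambda>d h. quats_of_mat
    (fst d * h, fst (snd d) * h, fst (snd (snd d)) * h, snd (snd (snd d)) * h))"
  interpret Q: bounded_linear quats_of_mat by (rule bounded_linear_quats_of_mat)
  have L: "bounded_linear (L e)" for e
  proof -
    have "bounded_linear (\<lambda>h. (fst e * h, fst (snd e) * h, fst (snd (snd e)) * h, snd (snd (snd e)) * h))"
      by (intro bounded_linear_Pair bounded_linear_mult_right)
    from bounded_linear_compose[OF bounded_linear_quats_of_mat this] show ?thesis
      unfolding L_def .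
  qed
  define F' where "F' z = Blinfun (L (d z))" for z
  have F': "blinfun_apply (F' z) = L (d z)" for z
    unfolding F'_def using L by (rule bounded_linear_Blinfun_apply)
  have "(F has_derivative blinfun_apply (F' z)) (at z)" if z: "z \<in> D" for z
  proof -
    note der = hol[THEN holomorphic_derivI, OF D z, THEN has_field_derivative_imp_has_derivative]
    have "((\<lambda>z. quats_of_mat (mat11 (F z), mat12 (F z), mat21 (F z), mat22 (F z)))
        has_derivative L (d z)) (at z)"
      unfolding L_def d_def fst_conv snd_conv
      by (intro Q.has_derivative has_derivative_Pair der)
    then show ?thesis
      by (simp add: quats_of_mat_inverse F')
  qed
  moreover have "continuous_on D F'"
  proof (rule continuous_on_blinfun_componentwise)
    fix h :: complex
    note dcont = hol[THEN holomorphic_deriv, OF D, THEN holomorphic_on_imp_continuous_on]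
    show "continuous_on D (\<lambda>z. blinfun_apply (F' z) h)"
      unfolding F' L_def d_def fst_conv snd_conv
      by (intro Q.continuous_on continuous_intros dcont)
  qed
  moreover have "blinfun_apply (F' z) 1 + sqrt_minus_one_times (blinfun_apply (F' z) \<i>) = 0" for z
  proof -
    have "sqrt_minus_one_times (L (d z) \<i>) = L (d z) (\<i> * \<i>)"
      unfolding L_def quats_of_mat_times_i[symmetric] by (simp add: mult_ac)
    also have "\<dots> = - L (d z) 1"
      using linear_neg[OF bounded_linear.linear[OF L], of "d z" 1] by simp
    finally show ?thesis
      by (simp add: F')
  qed
  ultimately show ?thesis
    unfolding slice_regular_def using F by blast
qed

section \<open>The correspondence\<close>

theorem theorem32:
  fixes D :: "complex set"
  assumes "open D" and "connected D" and "D \<noteq> {}" and "D \<subseteq> upper_half_plane"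
  shows "(\<forall>f. slice_function D f \<longrightarrow> Gr2_curve D (twistor_transform D f)) \<and>
    (\<forall>\<gamma>. Gr2_curve D \<gamma> \<and> (\<forall>v\<in>D. coord_nonzero 6 (klein (\<gamma> v))) \<longrightarrow>
      (\<exists>f. slice_function D f \<and> (\<forall>v\<in>D. \<gamma> v = twistor_transform D f v))) \<and>
    (\<forall>f. slice_function D f \<longrightarrow>
      (slice_regular D f \<longleftrightarrow> Gr2_holomorphic_curve D (twistor_transform D f)))"
proof (intro conjI allI impI)
  note graph = twistor_transform_eq_graph_plane[OF _ _ assms(4)]
  fix f assume "slice_function D f"
  then obtain F where F: "slice_function_of D F f" "continuous_on D F"
    by (auto simp: slice_function_def)
  note cont = bounded_linear_mat[THEN bounded_linear.continuous_on, OF F(2)]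
  show "Gr2_curve D (twistor_transform D f)"
    using cont graph[OF F(1)] by (rule Gr2_curve_graph_plane)
  show "slice_regular D f \<longleftrightarrow> Gr2_holomorphic_curve D (twistor_transform D f)"
  proof
    assume "slice_regular D f"
    then obtain G G' where G: "slice_function_of D G f"
      "\<And>z. z \<in> D \<Longrightarrow> (G has_derivative blinfun_apply (G' z)) (at z)"
      "\<And>z. z \<in> D \<Longrightarrow> blinfun_apply (G' z) 1 + sqrt_minus_one_times (blinfun_apply (G' z) \<i>) = 0"
      unfolding slice_regular_def by blast
    note hol = holomorphic_on_complex_linear_image[OF _ _ assms(1) G(2,3)]
    show "Gr2_holomorphic_curve D (twistor_transform D f)"
      by (rule Gr2_holomorphic_curve_graph_plane[OF _ _ _ _ graph[OF G(1)]])
        (rule hol; (rule bounded_linear_mat mat_sqrt_minus_one_times | assumption))+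
  next
    assume "Gr2_holomorphic_curve D (twistor_transform D f)"
    note hol = Gr2_holomorphic_curve_graph_planeD[OF this graph[OF F(1)]]
    show "slice_regular D f"
      by (rule slice_regular_if_mat_holomorphic[OF assms(1) F(1) hol])
  qed
next
  fix \<gamma> assume \<gamma>: "Gr2_curve D \<gamma> \<and> (\<forall>v\<in>D. coord_nonzero 6 (klein (\<gamma> v)))"
  define c where "c j v = affine_coord 6 j (klein (\<gamma> v))" for j :: 6 and v
  have c: "continuous_on D (c j)" for j
    using continuous_on_affine_coord[of D "klein \<circ> \<gamma>" 6 j] \<gamma>
    by (simp add: Gr2_curve_iff c_def[abs_def])
  define F where "F v = quats_of_mat (- c 3 v, c 2 v, - c 5 v, c 4 v)" for v
  have "continuous_on D F"
    unfolding F_def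
    by (intro bounded_linear.continuous_on[OF bounded_linear_quats_of_mat] continuous_intros c)
  moreover have F: "slice_function_of D F (slice_extension F)"
    using assms(4) by (rule slice_function_of_slice_extension)
  moreover have "\<gamma> v = twistor_transform D (slice_extension F) v" if "v \<in> D" for v
    unfolding twistor_transform_eq_graph_plane[OF F that assms(4)]
    using graph_plane_of_klein[of "\<gamma> v"] \<gamma> that
    by (simp add: F_def mat_quats_of_mat Gr2_curve_iff c_def)
  ultimately show "\<exists>f. slice_function D f \<and> (\<forall>v\<in>D. \<gamma> v = twistor_transform D f v)"
    unfolding slice_function_def by blast
qed

end
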